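(* Let $\gamma\in\mathbb{R}$ and consider the stochastic dynamic on $\{+1,-1\}^{\mathbb{Z}}$ $$\phi(x,t+1)=\mathrm{sgn}\{K_{\lambda(t)}(\phi(x-1,t)+\phi(x+1,t))+(1-\gamma)\phi(x,t)+\xi(x,t)\},\qquad x\in\mathbb{Z},\ t=0,1,2,\dots,$$ with system parameter $K_{\lambda(t)}$ and initial distribution $\phi(\cdot,0)\sim\mathbb{P}_0$. Choose a scaling parameter $\lambda(t)\uparrow+\infty$ as $t\to+\infty$, and suppose $K_{\lambda(t)}\to K^*=0$. Then for every positive integer $m\ge1$, all distinct sites $x_1,\dots,x_m\in\mathbb{Z}$ and every real function $f$ of $m$ spins, the finite point observable satisfies $$\mathcal{E}^{f}_{\lambda(t)}(x_1,\dots,x_m)\to\mathbb{E}_{K^*=0}[f^2]\qquad\text{as }t\to\infty,$$ where $\mathbb{E}_{K^*=0}[f^2]$ is the observable at the fixed point, and this result is independent of $\mathbb{P}_0$.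
   Context: The $\{\xi(x,t)\}_{x\in\mathbb{Z},t\ge0}$ are independent standard Gaussian random variables, independent of $\phi(\cdot,0)$; $K_{\lambda(t)}$ is a deterministic real coupling parameter. In the paper $\mathbb{P}_0$ is the infinite-volume Gibbs measure of the zero-field nearest-neighbour Ising model on $\mathbb{Z}$ with coupling $K$, i.e. it satisfies the DLR equations: for every finite $\Lambda\subset\mathbb{Z}$, $\mathbb{P}_0(\phi(x,0)=\sigma_x,x\in\Lambda\mid\phi(y,0)=\sigma_y,y\in\Lambda^c)=Z_{\partial_\Lambda}^{-1}\exp\{K\sum\sigma_x\sigma_y\}$ (sum over nearest-neighbour pairs with at least one element in $\Lambda$); "independent of $\mathbb{P}_0$" means that the convergence and its limit do not depend on the choice of the initial probability distribution. The finite point observable is $\mathcal{E}^f_{\lambda(t)}(x_1,\dots,x_m)=\mathbb{E}[f^2(\phi(x_1,t+1),\dots,\phi(x_m,t+1))]$, the expectation being for the dynamic. $\mathbb{E}_{K^*=0}[f^2]$ is the expectation of $f^2(\sigma_1,\dots,\sigma_m)$ for the Ising model at coupling $0$, i.e. for independent spins $\sigma_i$ uniform on $\{\pm1\}$. Only the values of $f$ on $\{\pm1\}^m$ matter. *)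

theory Defs
  imports "HOL-Probability.Probability"
begin

text \<open>Spins are the real numbers \<open>-1\<close> and \<open>1\<close>; this is the product sigma-algebra on
  \<open>{-1,1}\<close>-valued configurations over the integers.\<close>

definition spin_configs :: "(int \<Rightarrow> real) measure" where
  "spin_configs = (\<Pi>\<^sub>M x\<in>UNIV. count_space {-1, 1})"

text \<open>The constant \<open>indep_var\<close> requires both variables to have the same type; this is the same notion
  for two variables of different types.\<close>

definition indep_random_elements ::
  "'w measure \<Rightarrow> 'a measure \<Rightarrow> ('w \<Rightarrow> 'a) \<Rightarrow> 'b measure \<Rightarrow> ('w \<Rightarrow> 'b) \<Rightarrow> bool"
where
  "indep_random_elements M S X T Y \<longleftrightarrow>
     X \<in> M \<rightarrow>\<^sub>M S \<and> Y \<in> M \<rightarrow>\<^sub>M T \<and>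
     prob_space.indep_set M {X -` A \<inter> space M | A. A \<in> sets S} {Y -` B \<inter> space M | B. B \<in> sets T}"

text \<open>The almost sure formulation of the update rule makes the value of \<open>sgn\<close> at \<open>0\<close> irrelevant:
  its argument is nonzero almost surely, because the noise is Gaussian and independent of the
  spins at time \<open>t\<close>. (The library function has \<open>sgn 0 = 0\<close>, which is not a spin.)\<close>

definition noisy_sign_dynamic ::
  "'w measure \<Rightarrow> real \<Rightarrow> (nat \<Rightarrow> real) \<Rightarrow> (int \<Rightarrow> nat \<Rightarrow> 'w \<Rightarrow> real) \<Rightarrow> (int \<Rightarrow> nat \<Rightarrow> 'w \<Rightarrow> real) \<Rightarrow> bool"
where
  "noisy_sign_dynamic M \<gamma> k \<xi> \<phi> \<longleftrightarrow>
     (\<forall>x t. \<phi> x t \<in> M \<rightarrow>\<^sub>M count_space {-1, 1}) \<and>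
     (\<forall>x t. AE \<omega> in M. \<phi> x (t + 1) \<omega> =
        sgn (k t * (\<phi> (x - 1) t \<omega> + \<phi> (x + 1) t \<omega>) + (1 - \<gamma>) * \<phi> x t \<omega> + \<xi> x t \<omega>))"

definition finite_point_observable ::
  "'w measure \<Rightarrow> (int \<Rightarrow> nat \<Rightarrow> 'w \<Rightarrow> real) \<Rightarrow> (real list \<Rightarrow> real) \<Rightarrow> int list \<Rightarrow> nat \<Rightarrow> real"
where
  "finite_point_observable M \<phi> f xs t = (\<integral>\<omega>. (f (map (\<lambda>x. \<phi> x (t + 1) \<omega>) xs))\<^sup>2 \<partial>M)"

text \<open>The Ising model at coupling \<open>0\<close>: \<open>m\<close> independent spins, uniform on \<open>{-1,1}\<close>.\<close>

definition ising_zero_coupling :: "nat \<Rightarrow> real list pmf" where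
  "ising_zero_coupling m = replicate_pmf m (pmf_of_set {-1, 1})"

end

theory Submission imports Defs begin

text \<open>For a finite nonempty set \<open>S\<close> of sites let \<open>a t\<close> be the expected product of the spins in
  \<open>S\<close> at time \<open>t\<close>. The noise at time \<open>t\<close> is independent of the spins at time \<open>t\<close>, so averaging over
  it replaces each sign by its mean \<open>G u = E[sgn (u + \<xi>)]\<close>. The function \<open>G\<close> is odd and continuous
  with \<open>\<bar>G\<bar> < 1\<close>; as the coupling vanishes, \<open>G\<close> of the local field at \<open>x\<close> approaches
  \<open>G (1 - \<gamma>)\<close> times the spin at \<open>x\<close>. Hence \<open>a (t + 1) = G (1 - \<gamma>) ^ card S * a t + o(1)\<close>, and
  \<open>a t\<close> tends to \<open>0\<close>: all the correlations vanish in the limit, which characterises independent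
  uniform spins. For a deterministic initial configuration this is literally the argument; a random
  initial distribution is then integrated out by dominated convergence.\<close>

section \<open>Mean of a sign under Gaussian noise\<close>

text \<open>Unlike \<open>sgn\<close>, this takes only the values \<open>-1\<close> and \<open>1\<close>, so that \<open>evolve\<close> below stays among
  the spin configurations for every noise. It agrees with \<open>sgn\<close> along the dynamic almost surely.\<close>

definition spin_sign :: "real \<Rightarrow> real" where
  "spin_sign z = (if 0 < z then 1 else -1)"

lemma spin_sign_measurable [measurable]: "spin_sign \<in> borel_measurable borel"
  unfolding spin_sign_def by measurable

lemma abs_spin_sign [simp]: "\<bar>spin_sign z\<bar> = 1"
  by (simp add: spin_sign_def)

definition mean_sign :: "real \<Rightarrow> real" where
  "mean_sign u = (\<integral>y. spin_sign (u + y) \<partial>std_normal_distribution)"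

interpretation std_normal: real_distribution std_normal_distribution
  by (rule real_dist_normal_dist)

text \<open>The normal density is strictly positive everywhere, so the Gaussian law and Lebesgue
  measure have the same null sets.\<close>

lemma AE_std_normal_iff:
  assumes "Measurable.pred borel P"
  shows "(AE y in std_normal_distribution. P y) \<longleftrightarrow> (AE y in lborel. P y)"
  using assms by (subst AE_density) (auto simp: normal_density_pos ennreal_less_zero_iff)

lemma std_normal_singleton: "measure std_normal_distribution {a} = 0"
proof -
  have "AE y in std_normal_distribution. y \<noteq> a"
    using AE_lborel_singleton by (subst AE_std_normal_iff) auto
  then have "{a} \<in> null_sets std_normal_distribution"
    by (subst AE_iff_null_sets) (auto elim: eventually_mono)
  then show ?thesis by (simp add: measure_def null_setsD1)
qed

text \<open>The integrand is 1 minus twice the indicator of the half-line up to \<open>-u\<close>.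
  Continuity and bounds can then be read off the distribution function.\<close>

lemma mean_sign_eq_cdf: "mean_sign u = 1 - 2 * cdf std_normal_distribution (- u)"
proof -
  have "mean_sign u = (\<integral>y. 1 - 2 * indicator {..-u} y \<partial>std_normal_distribution)"
    unfolding mean_sign_def
    by (intro Bochner_Integration.integral_cong)
       (auto simp: spin_sign_def indicator_def)
  also have "\<dots> = 1 - 2 * cdf std_normal_distribution (- u)"
    by (simp add: cdf_def std_normal.prob_space[simplified] std_normal.emeasure_finite less_top[symmetric])
  finally show ?thesis .
qed

text \<open>A distribution function is continuous exactly at the points without an atom, and the
  Gaussian law has none.\<close>

lemma isCont_mean_sign: "isCont mean_sign u"
proof -
  define F where "F = cdf std_normal_distribution"
  have "isCont F (- u)"
    unfolding F_def by (simp only: std_normal.isCont_cdf std_normal_singleton)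
  then have "isCont (\<lambda>u. F (- u)) u"
    using isCont_o2[of u uminus F] by simp
  then have "isCont (\<lambda>u. 1 - 2 * F (- u)) u"
    by (intro continuous_intros)
  moreover have "mean_sign = (\<lambda>u. 1 - 2 * F (- u))"
    unfolding F_def by (rule ext) (rule mean_sign_eq_cdf)
  ultimately show ?thesis by simp
qed

text \<open>Reflecting \<open>y\<close> to \<open>-y\<close> preserves the density.
  \<open>spin_sign\<close> fails to be odd only at argument 0, which here is the null event
  \<open>y = -u\<close>.\<close>

lemma mean_sign_minus: "mean_sign (- u) = - mean_sign u"
proof -
  have "mean_sign (- u) = (\<integral>y. std_normal_density y * spin_sign (- u + y) \<partial>lborel)"
    unfolding mean_sign_def by (subst integral_density) auto
  also have "\<dots> = (\<integral>y. std_normal_density (-y) * spin_sign (- u + - y) \<partial>lborel)"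
    by (subst lborel_integral_real_affine[of "-1" _ 0]) auto
  also have "\<dots> = (\<integral>y. - (std_normal_density y * spin_sign (u + y)) \<partial>lborel)"
  proof (rule integral_cong_AE)
    have "AE y in lborel. y \<noteq> - u" by (rule AE_lborel_singleton)
    then show "AE y in lborel. std_normal_density (- y) * spin_sign (- u + - y)
        = - (std_normal_density y * spin_sign (u + y))"
      by eventually_elim (auto simp: spin_sign_def std_normal_density_def)
  qed measurable
  also have "\<dots> = - mean_sign u"
    unfolding mean_sign_def by (subst integral_density) auto
  finally show ?thesis .
qed

text \<open>A half-line that is null for the Gaussian law would be null for Lebesgue measure, yet it
  contains an interval of length 1.\<close>

lemma cdf_std_normal_pos: "0 < cdf std_normal_distribution u"
proof (rule ccontr)
  assume "\<not> ?thesis"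
  then have "measure std_normal_distribution {..u} = 0"
    using std_normal.cdf_nonneg[of u] unfolding cdf_def by linarith
  then have "AE y in std_normal_distribution. y \<notin> {..u}"
    using std_normal.emeasure_eq_measure by (subst AE_iff_null_sets[symmetric]) (auto simp: null_sets_def)
  then have "AE y in lborel. y \<notin> {..u}"
    by (subst (asm) AE_std_normal_iff) auto
  then have "{..u} \<in> null_sets lborel"
    by (subst AE_iff_null_sets) auto
  moreover have "emeasure lborel {u-1..u} \<le> emeasure lborel {..u}"
    by (intro emeasure_mono) auto
  ultimately show False by (simp add: null_setsD1)
qed

text \<open>Strictness is what will make the correlations contract. The upper bound is positivity of
  the distribution function; oddness turns it into the lower bound.\<close>

lemma abs_mean_sign_less_1: "\<bar>mean_sign u\<bar> < 1"
proof -
  have "mean_sign v < 1" for v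
    using cdf_std_normal_pos[of "-v"] by (simp add: mean_sign_eq_cdf)
  from this[of u] this[of "-u"] show ?thesis by (simp add: mean_sign_minus)
qed

text \<open>Once the errors are small, the excess of the sequence over half the tolerance shrinks
  geometrically.\<close>

lemma tendsto_zero_of_contraction:
  fixes a e :: "nat \<Rightarrow> real"
  assumes r: "0 \<le> r" "r < 1"
    and step: "\<And>n. \<bar>a (Suc n)\<bar> \<le> r * \<bar>a n\<bar> + e n"
    and e: "e \<longlonglongrightarrow> 0"
  shows "a \<longlonglongrightarrow> 0"
proof (rule LIMSEQ_I)
  fix \<epsilon> :: real assume \<epsilon>: "0 < \<epsilon>"
  \<comment> \<open>This choice makes \<epsilon>/2 the fixed point of the map sending v to r * v +
    \<delta>, so the bound below reproduces itself.\<close>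
  define \<delta> where "\<delta> = \<epsilon> / 2 * (1 - r)"
  have "0 < \<delta>" using \<epsilon> r by (simp add: \<delta>_def)
  then have "eventually (\<lambda>n. e n < \<delta>) sequentially"
    using order_tendstoD(2)[OF e] by blast
  then obtain N where N: "\<And>n. n \<ge> N \<Longrightarrow> e n < \<delta>"
    by (auto simp: eventually_sequentially)
  have bound: "\<bar>a (N + n)\<bar> \<le> r ^ n * \<bar>a N\<bar> + \<epsilon> / 2" for n
  proof (induction n)
    case 0 then show ?case using \<epsilon> by simp
  next
    case (Suc n)
    have "\<bar>a (N + Suc n)\<bar> \<le> r * \<bar>a (N + n)\<bar> + \<delta>"
      using step[of "N + n"] N[of "N + n"] by simp
    also have "\<dots> \<le> r * (r ^ n * \<bar>a N\<bar> + \<epsilon> / 2) + \<delta>"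
      using Suc r by (intro add_right_mono mult_left_mono) auto
    also have "\<dots> = r ^ Suc n * \<bar>a N\<bar> + \<epsilon> / 2"
      by (simp add: \<delta>_def field_simps)
    finally show ?case .
  qed
  have "(\<lambda>n. r ^ n * \<bar>a N\<bar>) \<longlonglongrightarrow> 0"
    using r by (intro tendsto_mult_left_zero LIMSEQ_realpow_zero) auto
  then have "eventually (\<lambda>n. r ^ n * \<bar>a N\<bar> < \<epsilon> / 2) sequentially"
    using \<epsilon> by (intro order_tendstoD(2)) auto
  then obtain L where L: "\<And>n. n \<ge> L \<Longrightarrow> r ^ n * \<bar>a N\<bar> < \<epsilon> / 2"
    by (auto simp: eventually_sequentially)
  show "\<exists>no. \<forall>n\<ge>no. norm (a n - 0) < \<epsilon>"
  proof (intro exI allI impI)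
    fix n assume n: "N + L \<le> n"
    have "\<bar>a n\<bar> \<le> r ^ (n - N) * \<bar>a N\<bar> + \<epsilon> / 2" "r ^ (n - N) * \<bar>a N\<bar> < \<epsilon> / 2"
      using bound[of "n - N"] L[of "n - N"] n by simp_all
    then show "norm (a n - 0) < \<epsilon>" by simp
  qed
qed

section \<open>Averaging over independent noise\<close>

lemma (in prob_space) indep_random_elements_distr:
  assumes "indep_random_elements M S X T Y"
  shows "distr M (S \<Otimes>\<^sub>M T) (\<lambda>\<omega>. (X \<omega>, Y \<omega>)) = distr M S X \<Otimes>\<^sub>M distr M T Y"
proof -
  have [measurable]: "X \<in> M \<rightarrow>\<^sub>M S" "Y \<in> M \<rightarrow>\<^sub>M T"
    and ind: "indep_set {X -` A \<inter> space M | A. A \<in> sets S} {Y -` B \<inter> space M | B. B \<in> sets T}"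
    using assms by (auto simp: indep_random_elements_def)
  interpret X: prob_space "distr M S X" by (rule prob_space_distr) measurable
  interpret Y: prob_space "distr M T Y" by (rule prob_space_distr) measurable
  show ?thesis
  proof (rule pair_measure_eqI[symmetric])
    fix A B assume AB: "A \<in> sets (distr M S X)" "B \<in> sets (distr M T Y)"
    then have [measurable]: "A \<in> sets S" "B \<in> sets T" by auto
    have "emeasure (distr M (S \<Otimes>\<^sub>M T) (\<lambda>\<omega>. (X \<omega>, Y \<omega>))) (A \<times> B)
      = emeasure M ((X -` A \<inter> space M) \<inter> (Y -` B \<inter> space M))"
      by (subst emeasure_distr) (auto intro!: arg_cong[where f = "emeasure M"])
    also have "\<dots> = emeasure M (X -` A \<inter> space M) * emeasure M (Y -` B \<inter> space M)"
      unfolding emeasure_eq_measure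
      by (subst indep_setD[OF ind]) (auto simp: ennreal_mult)
    also have "\<dots> = emeasure (distr M S X) A * emeasure (distr M T Y) B"
      by (simp add: emeasure_distr)
    finally show "emeasure (distr M S X) A * emeasure (distr M T Y) B =
      emeasure (distr M (S \<Otimes>\<^sub>M T) (\<lambda>\<omega>. (X \<omega>, Y \<omega>))) (A \<times> B)" ..
  qed (auto intro: X.sigma_finite_measure_axioms Y.sigma_finite_measure_axioms)
qed

text \<open>Fubini for the product law. With both integrals taken over \<open>M\<close>, results
  about a frozen first argument apply directly to the inner one.\<close>

lemma (in prob_space) expectation_decouple:
  fixes g :: "'b \<times> 'c \<Rightarrow> real"
  assumes ind: "indep_random_elements M S X T Y"
    and g [measurable]: "g \<in> borel_measurable (S \<Otimes>\<^sub>M T)"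
    and bd: "\<And>x y. \<bar>g (x, y)\<bar> \<le> B"
  shows "expectation (\<lambda>\<omega>. g (X \<omega>, Y \<omega>)) = expectation (\<lambda>\<omega>. expectation (\<lambda>\<omega>'. g (X \<omega>, Y \<omega>')))"
proof -
  have [measurable]: "X \<in> M \<rightarrow>\<^sub>M S" "Y \<in> M \<rightarrow>\<^sub>M T"
    using ind by (auto simp: indep_random_elements_def)
  interpret X: prob_space "distr M S X" by (rule prob_space_distr) measurable
  interpret Y: prob_space "distr M T Y" by (rule prob_space_distr) measurable
  interpret XY: pair_prob_space "distr M S X" "distr M T Y" ..
  have "expectation (\<lambda>\<omega>. g (X \<omega>, Y \<omega>)) = integral\<^sup>L (distr M (S \<Otimes>\<^sub>M T) (\<lambda>\<omega>. (X \<omega>, Y \<omega>))) g"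
    by (subst integral_distr) auto
  also have "\<dots> = integral\<^sup>L (distr M S X \<Otimes>\<^sub>M distr M T Y) g"
    by (simp add: indep_random_elements_distr[OF ind])
  also have "\<dots> = (\<integral>x. (\<integral>y. g (x, y) \<partial>distr M T Y) \<partial>distr M S X)"
    using bd by (intro XY.integral_fst'[symmetric] XY.integrable_const_bound[where B = B]) auto
  also have "\<dots> = expectation (\<lambda>\<omega>. (\<integral>y. g (X \<omega>, y) \<partial>distr M T Y))"
    by (subst integral_distr) auto
  also have "\<dots> = expectation (\<lambda>\<omega>. expectation (\<lambda>\<omega>'. g (X \<omega>, Y \<omega>')))"
    by (intro Bochner_Integration.integral_cong integral_distr) 
       (auto intro!: measurable_compose[OF measurable_Pair1' g] measurable_space[of X M S])
  finally show ?thesis .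
qed

text \<open>\<open>indep_var_restrict\<close> makes the generated sigma-algebras independent, and
  these contain the preimage families. It serves to separate the noise at time \<open>t\<close> from
  the earlier noise.\<close>

lemma (in prob_space) indep_random_elements_restrict:
  assumes "indep_vars M' X I" "A \<inter> B = {}" "A \<subseteq> I" "B \<subseteq> I"
  shows "indep_random_elements M (PiM A M') (\<lambda>\<omega>. \<lambda>i\<in>A. X i \<omega>) (PiM B M') (\<lambda>\<omega>. \<lambda>i\<in>B. X i \<omega>)"
proof -
  note ind = indep_var_restrict[OF assms, unfolded indep_var_eq]
  then show ?thesis
    unfolding indep_random_elements_def indep_set_def
    by (auto elim!: indep_sets_mono_sets split: bool.split)
qed

section \<open>The dynamic as a function of initial configuration and noise\<close>

definition local_field :: "real \<Rightarrow> real \<Rightarrow> (int \<Rightarrow> real) \<Rightarrow> int \<Rightarrow> real" where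
  "local_field \<gamma> c \<sigma> x = c * (\<sigma> (x - 1) + \<sigma> (x + 1)) + (1 - \<gamma>) * \<sigma> x"

text \<open>The solution map of the dynamic. With the initial configuration and the noise as
  explicit arguments, one can be frozen while the other is averaged.\<close>

primrec evolve ::
  "real \<Rightarrow> (nat \<Rightarrow> real) \<Rightarrow> (int \<Rightarrow> real) \<Rightarrow> (int \<times> nat \<Rightarrow> real) \<Rightarrow> nat \<Rightarrow> int \<Rightarrow> real"
where
  "evolve \<gamma> k \<sigma> \<eta> 0 = \<sigma>"
| "evolve \<gamma> k \<sigma> \<eta> (Suc t) =
     (\<lambda>x. spin_sign (local_field \<gamma> (k t) (evolve \<gamma> k \<sigma> \<eta> t) x + \<eta> (x, t)))"

lemma space_spin_configsD: "\<sigma> \<in> space spin_configs \<Longrightarrow> \<sigma> x \<in> {-1, 1}"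
  by (auto simp: spin_configs_def space_PiM)

lemma borel_measurable_count_space_spins:
  fixes f :: "'a \<Rightarrow> real"
  assumes "f \<in> M \<rightarrow>\<^sub>M count_space {-1, 1}"
  shows "f \<in> borel_measurable M"
  using measurable_compose[OF assms, of "\<lambda>x. x" borel] by simp

lemma spin_configs_component [measurable]: "(\<lambda>\<sigma>. \<sigma> x) \<in> borel_measurable spin_configs"
  unfolding spin_configs_def
  by (intro borel_measurable_count_space_spins measurable_component_singleton) simp

lemma evolve_spin: "(\<And>x. \<sigma> x \<in> {-1, 1}) \<Longrightarrow> evolve \<gamma> k \<sigma> \<eta> t x \<in> {-1, 1}"
  by (cases t) (auto simp: spin_sign_def)

lemma abs_evolve: "\<sigma> \<in> space spin_configs \<Longrightarrow> \<bar>evolve \<gamma> k \<sigma> \<eta> t x\<bar> = 1"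
  using evolve_spin[of \<sigma> \<gamma> k \<eta> t x] space_spin_configsD[of \<sigma>] by auto

text \<open>Causality: only noise strictly before \<open>t\<close> has entered the state at time
  \<open>t\<close>, so the noise at time \<open>t\<close> is still fresh.\<close>

lemma evolve_cong:
  "(\<And>x s. s < t \<Longrightarrow> \<eta> (x, s) = \<eta>' (x, s)) \<Longrightarrow> evolve \<gamma> k \<sigma> \<eta> t = evolve \<gamma> k \<sigma> \<eta>' t"
  by (induction t) simp_all

text \<open>A general index set \<open>J\<close> covers both the noise before \<open>t\<close> alone
  and the whole noise field.\<close>

lemma evolve_measurable:
  assumes "UNIV \<times> {..<t} \<subseteq> J"
  shows "(\<lambda>(\<sigma>, \<eta>). evolve \<gamma> k \<sigma> \<eta> t x)
    \<in> borel_measurable (spin_configs \<Otimes>\<^sub>M PiM J (\<lambda>_. borel))"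
  using assms
proof (induction t arbitrary: x)
  case 0
  show ?case by (simp add: split_beta')
next
  case (Suc t)
  have "UNIV \<times> {..<t} \<subseteq> J" using Suc.prems by auto
  note [measurable] = Suc.IH[OF this, unfolded split_beta']
  have "(x, t) \<in> J" using Suc.prems by auto
  then have [measurable]: "(\<lambda>p. snd p (x, t)) \<in> borel_measurable (spin_configs \<Otimes>\<^sub>M PiM J (\<lambda>_. borel))"
    by (intro measurable_compose[OF measurable_snd] measurable_component_singleton)
  show ?case
    by (simp add: split_beta' local_field_def) measurable
qed

section \<open>Decay of correlations from a fixed initial configuration\<close>

lemma abs_prod_le_1:
  fixes f :: "'i \<Rightarrow> real"
  assumes "\<And>i. i \<in> I \<Longrightarrow> \<bar>f i\<bar> \<le> 1"
  shows "\<bar>\<Prod>i\<in>I. f i\<bar> \<le> 1"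
  unfolding abs_prod using assms by (intro prod_le_1) auto

lemma (in prob_space) expectation_prod_spin_sign:
  fixes \<Xi> :: "int \<times> nat \<Rightarrow> 'a \<Rightarrow> real"
  assumes gauss: "\<And>p. distributed M lborel (\<Xi> p) std_normal_density"
    and ind: "indep_vars (\<lambda>_. borel) \<Xi> UNIV"
    and S: "finite S"
  shows "expectation (\<lambda>\<omega>. \<Prod>x\<in>S. spin_sign (a x + \<Xi> (x, t) \<omega>)) = (\<Prod>x\<in>S. mean_sign (a x))"
proof -
  have [measurable]: "\<Xi> p \<in> borel_measurable M" for p
    using ind unfolding indep_vars_def by blast
  \<comment> \<open>The shift is read off the site component of \<open>p\<close>, so that
    independence over all of space-time transfers to this family.\<close>
  let ?X = "\<lambda>p \<omega>. spin_sign (a (fst p) + \<Xi> p \<omega>)"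
  have inj: "inj_on (\<lambda>x. (x, t)) S" by (auto simp: inj_on_def)
  have indX: "indep_vars (\<lambda>_. borel) ?X ((\<lambda>x. (x, t)) ` S)"
    by (intro indep_vars_subset[OF indep_vars_compose2[OF ind, of "\<lambda>p y. spin_sign (a (fst p) + y)"]]) auto
  have int: "integrable M (?X p)" for p
    by (intro integrable_const_bound[where B = 1]) auto
  have E: "expectation (?X p) = mean_sign (a (fst p))" for p
  proof -
    have "expectation (?X p) = (\<integral>y. spin_sign (a (fst p) + y) \<partial>distr M lborel (\<Xi> p))"
      by (subst integral_distr) auto
    also have "distr M lborel (\<Xi> p) = std_normal_distribution"
      using gauss[of p] by (simp add: distributed_def)
    finally show ?thesis by (simp add: mean_sign_def)
  qed
  have "expectation (\<lambda>\<omega>. \<Prod>x\<in>S. spin_sign (a x + \<Xi> (x, t) \<omega>))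
    = expectation (\<lambda>\<omega>. \<Prod>p\<in>(\<lambda>x. (x, t)) ` S. ?X p \<omega>)"
    by (simp add: prod.reindex[OF inj] o_def)
  also have "\<dots> = (\<Prod>p\<in>(\<lambda>x. (x, t)) ` S. expectation (?X p))"
    using S int by (intro indep_vars_lebesgue_integral indX) auto
  also have "\<dots> = (\<Prod>x\<in>S. mean_sign (a x))"
    by (simp add: E prod.reindex[OF inj] o_def)
  finally show ?thesis .
qed

text \<open>The spins at time \<open>t\<close> are a function of earlier noise, hence can be frozen
  while the fresh noise is averaged; each sign then becomes its mean.\<close>

lemma (in prob_space) expectation_prod_evolve_Suc:
  fixes \<Xi> :: "int \<times> nat \<Rightarrow> 'a \<Rightarrow> real"
  assumes gauss: "\<And>p. distributed M lborel (\<Xi> p) std_normal_density"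
    and ind: "indep_vars (\<lambda>_. borel) \<Xi> UNIV"
    and \<sigma>: "\<sigma> \<in> space spin_configs"
    and S: "finite S"
  shows "expectation (\<lambda>\<omega>. \<Prod>x\<in>S. evolve \<gamma> k \<sigma> (\<lambda>p. \<Xi> p \<omega>) (Suc t) x) =
    expectation (\<lambda>\<omega>. \<Prod>x\<in>S. mean_sign (local_field \<gamma> (k t) (evolve \<gamma> k \<sigma> (\<lambda>p. \<Xi> p \<omega>) t) x))"
proof -
  \<comment> \<open>\<open>A\<close> indexes the noise before time \<open>t\<close>,
    \<open>B\<close> the finitely many noise variables that drive the update of the sites in
    \<open>S\<close>.\<close>
  define A where "A = (UNIV :: int set) \<times> {..<t}"
  define B where "B = S \<times> {t}"
  define h where "h = (\<lambda>u x. local_field \<gamma> (k t) (evolve \<gamma> k \<sigma> u t) x)"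
  define g where "g = (\<lambda>(u, v). \<Prod>x\<in>S. spin_sign (h u x + v (x, t)))"
  have restr: "h (\<lambda>p\<in>A. \<Xi> p \<omega>) = h (\<lambda>p. \<Xi> p \<omega>)" for \<omega>
    unfolding h_def by (subst evolve_cong[of t _ "\<lambda>p. \<Xi> p \<omega>"]) (auto simp: A_def)
  have [measurable]: "(\<lambda>u. evolve \<gamma> k \<sigma> u t x) \<in> borel_measurable (PiM A (\<lambda>_. borel))" for x
    using measurable_compose[OF measurable_Pair1'[OF \<sigma>] evolve_measurable[of t A \<gamma> k x]]
    by (simp add: A_def)
  have [measurable]: "(\<lambda>u. h u x) \<in> borel_measurable (PiM A (\<lambda>_. borel))" for x
    unfolding h_def local_field_def by measurable
  have g_meas: "g \<in> borel_measurable (PiM A (\<lambda>_. borel) \<Otimes>\<^sub>M PiM B (\<lambda>_. borel))"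
    unfolding g_def split_beta'
  proof (intro borel_measurable_prod)
    fix x assume "x \<in> S"
    then have [measurable]: "(\<lambda>p. snd p (x, t))
        \<in> borel_measurable (PiM A (\<lambda>_. borel) \<Otimes>\<^sub>M PiM B (\<lambda>_. borel))"
      by (intro measurable_compose[OF measurable_snd] measurable_component_singleton) (simp add: B_def)
    show "(\<lambda>p. spin_sign (h (fst p) x + snd p (x, t)))
        \<in> borel_measurable (PiM A (\<lambda>_. borel) \<Otimes>\<^sub>M PiM B (\<lambda>_. borel))"
      by measurable
  qed
  have g_bound: "\<bar>g (u, v)\<bar> \<le> 1" for u v
    unfolding g_def by (simp add: abs_prod_le_1)
  have "indep_random_elements M (PiM A (\<lambda>_. borel)) (\<lambda>\<omega>. \<lambda>p\<in>A. \<Xi> p \<omega>)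
      (PiM B (\<lambda>_. borel)) (\<lambda>\<omega>. \<lambda>p\<in>B. \<Xi> p \<omega>)"
    by (intro indep_random_elements_restrict[OF ind]) (auto simp: A_def B_def)
  note expectation_decouple[OF this g_meas g_bound]
  moreover have "g (\<lambda>p\<in>A. \<Xi> p \<omega>, \<lambda>p\<in>B. \<Xi> p \<omega>')
      = (\<Prod>x\<in>S. spin_sign (h (\<lambda>p. \<Xi> p \<omega>) x + \<Xi> (x, t) \<omega>'))" for \<omega> \<omega>'
    unfolding g_def by (auto simp: restr B_def intro!: prod.cong)
  ultimately have "expectation (\<lambda>\<omega>. \<Prod>x\<in>S. spin_sign (h (\<lambda>p. \<Xi> p \<omega>) x + \<Xi> (x, t) \<omega>)) =
      expectation (\<lambda>\<omega>. expectation (\<lambda>\<omega>'. \<Prod>x\<in>S. spin_sign (h (\<lambda>p. \<Xi> p \<omega>) x + \<Xi> (x, t) \<omega>')))"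
    by simp
  then show ?thesis
    by (simp add: h_def expectation_prod_spin_sign[OF gauss ind S])
qed

text \<open>The two neighbours sum to -2, 0 or 2. Oddness factors out the spin at \<open>x\<close>,
  leaving \<open>mean_sign\<close> at \<open>1 - \<gamma>\<close> shifted by -2c, 0 or 2c; the sum
  of both deviations covers every case.\<close>

lemma mean_sign_local_field_close:
  assumes \<sigma>: "\<And>x. \<sigma> x \<in> {-1, 1}"
  shows "\<bar>mean_sign (local_field \<gamma> c \<sigma> x) - mean_sign (1 - \<gamma>) * \<sigma> x\<bar>
    \<le> \<bar>mean_sign (1 - \<gamma> + 2 * c) - mean_sign (1 - \<gamma>)\<bar>
      + \<bar>mean_sign (1 - \<gamma> - 2 * c) - mean_sign (1 - \<gamma>)\<bar>"
proof -
  define b where "b = 1 - \<gamma>"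
  \<comment> \<open>Oddness at the three arguments that occur when the spin at \<open>x\<close> is
    -1.\<close>
  have m: "mean_sign (- b) = - mean_sign b" "mean_sign (c * 2 - b) = - mean_sign (b - 2 * c)"
    "mean_sign (- b - c * 2) = - mean_sign (b + 2 * c)"
    using mean_sign_minus[of b] mean_sign_minus[of "b - 2 * c"] mean_sign_minus[of "b + 2 * c"]
    by (simp_all add: algebra_simps)
  show ?thesis
    using \<sigma>[of x] \<sigma>[of "x - 1"] \<sigma>[of "x + 1"]
    unfolding local_field_def b_def[symmetric]
    by (auto simp: m algebra_simps)
qed

lemma (in prob_space) expectation_prod_evolve_tendsto_0:
  fixes \<Xi> :: "int \<times> nat \<Rightarrow> 'a \<Rightarrow> real"
  assumes gauss: "\<And>p. distributed M lborel (\<Xi> p) std_normal_density"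
    and ind: "indep_vars (\<lambda>_. borel) \<Xi> UNIV"
    and \<sigma>: "\<sigma> \<in> space spin_configs"
    and S: "finite S" "S \<noteq> {}"
    and k: "k \<longlonglongrightarrow> 0"
  shows "(\<lambda>t. expectation (\<lambda>\<omega>. \<Prod>x\<in>S. evolve \<gamma> k \<sigma> (\<lambda>p. \<Xi> p \<omega>) t x)) \<longlonglongrightarrow> 0"
proof -
  have [measurable]: "\<Xi> p \<in> borel_measurable M" for p
    using ind unfolding indep_vars_def by blast
  define \<rho> where "\<rho> = mean_sign (1 - \<gamma>)"
  \<comment> \<open>The error per site of replacing the local field at \<open>x\<close> by
    \<open>1 - \<gamma>\<close> times the spin at \<open>x\<close>; it vanishes by continuity of
    \<open>mean_sign\<close>.\<close>
  define d where "d t = \<bar>mean_sign (1 - \<gamma> + 2 * k t) - \<rho>\<bar> + \<bar>mean_sign (1 - \<gamma> - 2 * k t) - \<rho>\<bar>" for t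
  define \<psi> where "\<psi> t \<omega> = evolve \<gamma> k \<sigma> (\<lambda>p. \<Xi> p \<omega>) t" for t \<omega>
  define a where "a t = expectation (\<lambda>\<omega>. \<Prod>x\<in>S. \<psi> t \<omega> x)" for t
  have \<rho>: "\<bar>\<rho>\<bar> < 1" unfolding \<rho>_def by (rule abs_mean_sign_less_1)
  have "(\<lambda>\<omega>. (\<sigma>, \<lambda>p. \<Xi> p \<omega>)) \<in> M \<rightarrow>\<^sub>M spin_configs \<Otimes>\<^sub>M PiM UNIV (\<lambda>_. borel)"
    using \<sigma> by (intro measurable_Pair measurable_PiM_single') (auto simp: space_PiM)
  from measurable_compose[OF this evolve_measurable]
  have [measurable]: "(\<lambda>\<omega>. \<psi> t \<omega> x) \<in> borel_measurable M" for t x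
    unfolding \<psi>_def by (simp add: split_beta')
  have [measurable]: "mean_sign \<in> borel_measurable borel"
    by (intro borel_measurable_continuous_onI continuous_at_imp_continuous_on) (auto simp: isCont_mean_sign)
  have \<psi>_spin: "\<psi> t \<omega> x \<in> {-1, 1}" for t \<omega> x
    unfolding \<psi>_def using space_spin_configsD[OF \<sigma>] by (rule evolve_spin)
  then have \<psi>_abs: "\<bar>\<psi> t \<omega> x\<bar> = 1" for t \<omega> x
    by (smt (verit, best) insert_iff empty_iff)
  have step: "\<bar>a (Suc t)\<bar> \<le> \<bar>\<rho>\<bar> ^ card S * \<bar>a t\<bar> + card S * d t" for t
  proof -
    let ?F = "\<lambda>\<omega>. \<Prod>x\<in>S. mean_sign (local_field \<gamma> (k t) (\<psi> t \<omega>) x)"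
    let ?G = "\<lambda>\<omega>. \<Prod>x\<in>S. \<rho> * \<psi> t \<omega> x"
    have F_le: "\<bar>mean_sign u\<bar> \<le> 1" for u
      using abs_mean_sign_less_1[of u] by simp
    have G_le: "\<bar>\<rho> * \<psi> t \<omega> x\<bar> \<le> 1" for \<omega> x
      using \<rho> by (simp add: abs_mult \<psi>_abs)
    have [measurable]: "(\<lambda>\<omega>. local_field \<gamma> (k t) (\<psi> t \<omega>) x) \<in> borel_measurable M" for x
      unfolding local_field_def by measurable
    have int: "integrable M ?F" "integrable M ?G"
      by (intro integrable_const_bound[where B = 1] AE_I2;
          simp add: abs_prod_le_1 F_le G_le)+
    have "\<bar>?F \<omega> - ?G \<omega>\<bar> \<le> card S * d t" for \<omega>
    proof -
      \<comment> \<open>Products whose factors have absolute value at most 1 differ by at most the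
        sum of the differences of the factors.\<close>
      have "\<bar>?F \<omega> - ?G \<omega>\<bar> \<le> (\<Sum>x\<in>S. \<bar>mean_sign (local_field \<gamma> (k t) (\<psi> t \<omega>) x) - \<rho> * \<psi> t \<omega> x\<bar>)"
        using norm_prod_diff[of S "\<lambda>x. mean_sign (local_field \<gamma> (k t) (\<psi> t \<omega>) x)" "\<lambda>x. \<rho> * \<psi> t \<omega> x"]
        by (simp add: F_le G_le)
      also have "\<dots> \<le> (\<Sum>x\<in>S. d t)"
        unfolding d_def \<rho>_def by (intro sum_mono mean_sign_local_field_close \<psi>_spin)
      finally show ?thesis by simp
    qed
    then have "expectation (\<lambda>\<omega>. \<bar>?F \<omega> - ?G \<omega>\<bar>) \<le> expectation (\<lambda>_. card S * d t)"
      using int by (intro integral_mono) auto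
    then have "\<bar>expectation ?F - expectation ?G\<bar> \<le> card S * d t"
      using integral_abs_bound[of M "\<lambda>\<omega>. ?F \<omega> - ?G \<omega>"] int by (simp add: prob_space)
    moreover have "expectation ?F = a (Suc t)"
      unfolding a_def \<psi>_def by (rule expectation_prod_evolve_Suc[OF gauss ind \<sigma> S(1), symmetric])
    moreover have "expectation ?G = \<rho> ^ card S * a t"
      by (simp add: a_def prod.distrib)
    ultimately show ?thesis
      using abs_triangle_ineq[of "a (Suc t) - \<rho> ^ card S * a t" "\<rho> ^ card S * a t"]
      by (simp add: abs_mult power_abs)
  qed
  have "(\<lambda>t. mean_sign (1 - \<gamma> + 2 * k t)) \<longlonglongrightarrow> \<rho>" "(\<lambda>t. mean_sign (1 - \<gamma> - 2 * k t)) \<longlonglongrightarrow> \<rho>"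
    unfolding \<rho>_def
    by (rule isCont_tendsto_compose[OF isCont_mean_sign]; auto intro!: tendsto_eq_intros k)+
  then have "d \<longlonglongrightarrow> 0"
    unfolding d_def by (auto intro!: tendsto_eq_intros)
  then have "(\<lambda>t. card S * d t) \<longlonglongrightarrow> 0"
    by (rule tendsto_mult_right_zero)
  \<comment> \<open>Since \<open>S\<close> is nonempty the exponent is positive, so the recursion is
    a genuine contraction.\<close>
  moreover have "\<bar>\<rho>\<bar> ^ card S < 1"
    using \<rho> S by (intro power_less_one_iff[THEN iffD2]) (auto simp: card_gt_0_iff)
  ultimately have "a \<longlonglongrightarrow> 0"
    using step by (intro tendsto_zero_of_contraction[of "\<bar>\<rho>\<bar> ^ card S" a]) auto
  then show ?thesis
    unfolding a_def \<psi>_def .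
qed

section \<open>From correlations to arbitrary observables\<close>

text \<open>For a spin \<open>s x\<close> and a sign c, the indicator of \<open>s x = c\<close> is
  (1 + c * s x) / 2. Expanding in c replaces the first list entry by a constant, at the price of a
  possible extra factor in the product.\<close>

lemma prod_mult_map_Cons_eq:
  fixes s :: "int \<Rightarrow> real"
  assumes "s x \<in> {-1, 1}" "finite S" "x \<notin> S"
  shows "(\<Prod>y\<in>S. s y) * g (map s (x # xs)) =
    ((\<Prod>y\<in>S. s y) * g (1 # map s xs) + (\<Prod>y\<in>insert x S. s y) * g (1 # map s xs)
     + (\<Prod>y\<in>S. s y) * g (-1 # map s xs) - (\<Prod>y\<in>insert x S. s y) * g (-1 # map s xs)) / 2"
  using assms by auto

text \<open>As \<open>g\<close> is an arbitrary function on lists, its measurability is obtained by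
  expanding the list entry by entry, until only bounded products of spins with constant coefficients
  remain.\<close>

lemma (in prob_space) integrable_prod_mult_map:
  fixes s :: "int \<Rightarrow> 'a \<Rightarrow> real" and g :: "real list \<Rightarrow> real"
  assumes s: "\<And>x. s x \<in> M \<rightarrow>\<^sub>M count_space {-1, 1}"
    and "distinct xs" "finite S" "S \<inter> set xs = {}"
  shows "integrable M (\<lambda>\<omega>. (\<Prod>x\<in>S. s x \<omega>) * g (map (\<lambda>x. s x \<omega>) xs))"
  using assms(2-4)
proof (induction xs arbitrary: S g)
  have val: "s x \<omega> \<in> {-1, 1}" if "\<omega> \<in> space M" for x \<omega>
    using measurable_space[OF s that] by simp
  {
    case Nil
    have [measurable]: "s x \<in> borel_measurable M" for x
      by (intro borel_measurable_count_space_spins s)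
    have "\<bar>s x \<omega>\<bar> \<le> 1" if "\<omega> \<in> space M" for x \<omega>
      using val[OF that, of x] by auto
    then have "integrable M (\<lambda>\<omega>. \<Prod>x\<in>S. s x \<omega>)"
      by (intro integrable_const_bound[where B = 1] AE_I2) (auto intro!: abs_prod_le_1)
    then show ?case by simp
  next
    case (Cons x xs)
    have int: "integrable M (\<lambda>\<omega>. (\<Prod>x\<in>S'. s x \<omega>) * g (c # map (\<lambda>x. s x \<omega>) xs))"
      if "S' = S \<or> S' = insert x S" for S' c
      using that Cons.prems by (intro Cons.IH[of S' "\<lambda>l. g (c # l)"]) auto
    show ?case
      using Cons.prems int
      by (subst Bochner_Integration.integrable_cong[OF refl prod_mult_map_Cons_eq[OF val]])
         (auto simp del: prod.insert)
  }
qed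

text \<open>Conditioning on the first spin; this matches the two constants in the expansion of an
  observable.\<close>

lemma expectation_ising_zero_coupling_Suc:
  fixes g :: "real list \<Rightarrow> real"
  shows "measure_pmf.expectation (ising_zero_coupling (Suc n)) g =
    (measure_pmf.expectation (ising_zero_coupling n) (\<lambda>l. g (1 # l))
     + measure_pmf.expectation (ising_zero_coupling n) (\<lambda>l. g (-1 # l))) / 2"
proof -
  have "finite (set_pmf (replicate_pmf n (pmf_of_set {-1, 1 :: real})))"
    by (simp add: set_replicate_pmf finite_lists_length_eq lists_eq_set)
  then show ?thesis
    unfolding ising_zero_coupling_def replicate_pmf.simps map_pmf_def[symmetric]
    by (subst pmf_expectation_bind_pmf_of_set) (auto simp: field_simps)
qed

text \<open>The correlations with a product over further sites strengthen the induction: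
  splitting off the first spin of the list moves it into that product.\<close>

lemma (in prob_space) tendsto_expectation_ising_zero_coupling:
  fixes s :: "int \<Rightarrow> nat \<Rightarrow> 'a \<Rightarrow> real" and g :: "real list \<Rightarrow> real"
  assumes s: "\<And>x t. s x t \<in> M \<rightarrow>\<^sub>M count_space {-1, 1}"
    and decay: "\<And>S. finite S \<Longrightarrow> S \<noteq> {} \<Longrightarrow> (\<lambda>t. expectation (\<lambda>\<omega>. \<Prod>x\<in>S. s x t \<omega>)) \<longlonglongrightarrow> 0"
    and "distinct xs" "finite S" "S \<inter> set xs = {}"
  shows "(\<lambda>t. expectation (\<lambda>\<omega>. (\<Prod>x\<in>S. s x t \<omega>) * g (map (\<lambda>x. s x t \<omega>) xs))) \<longlonglongrightarrow>
    (if S = {} then measure_pmf.expectation (ising_zero_coupling (length xs)) g else 0)"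
  using assms(3-5)
proof (induction xs arbitrary: S g)
  case Nil
  show ?case
    \<comment> \<open>The list is used up, so \<open>g []\<close> is a constant factor: for nonempty
      \<open>S\<close> the limit is \<open>decay\<close>, for empty \<open>S\<close> the product is
      1.\<close>
    using tendsto_mult_left_zero[OF decay[OF \<open>finite S\<close>], of "g []"]
    by (simp add: ising_zero_coupling_def prob_space)
next
  case (Cons x xs)
  have val: "s x t \<omega> \<in> {-1, 1}" if "\<omega> \<in> space M" for x t \<omega>
    using measurable_space[OF s that] by simp
  define e where "e S' c t = expectation (\<lambda>\<omega>. (\<Prod>y\<in>S'. s y t \<omega>) * g (c # map (\<lambda>y. s y t \<omega>) xs))" for S' c t
  have int: "integrable M (\<lambda>\<omega>. (\<Prod>y\<in>S'. s y t \<omega>) * g (c # map (\<lambda>y. s y t \<omega>) xs))"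
    if "S' = S \<or> S' = insert x S" for S' c t
    using that Cons.prems by (intro integrable_prod_mult_map[where s = "\<lambda>x. s x t" and g = "\<lambda>l. g (c # l)"] s) auto
  have lim: "e S' c \<longlonglongrightarrow> (if S' = {} then measure_pmf.expectation (ising_zero_coupling (length xs)) (\<lambda>l. g (c # l)) else 0)"
    if "S' = S \<or> S' = insert x S" for S' c
    unfolding e_def using that Cons.prems by (intro Cons.IH[of S' "\<lambda>l. g (c # l)"]) auto
  have "expectation (\<lambda>\<omega>. (\<Prod>y\<in>S. s y t \<omega>) * g (map (\<lambda>y. s y t \<omega>) (x # xs)))
      = (e S 1 t + e (insert x S) 1 t + e S (-1) t - e (insert x S) (-1) t) / 2" for t
    using Cons.prems int unfolding e_def
    by (subst Bochner_Integration.integral_cong[OF refl prod_mult_map_Cons_eq[OF val]])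
       (auto simp del: prod.insert)
  moreover have "(\<lambda>t. (e S 1 t + e (insert x S) 1 t + e S (-1) t - e (insert x S) (-1) t) / 2) \<longlonglongrightarrow>
      (if S = {} then measure_pmf.expectation (ising_zero_coupling (length (x # xs))) g else 0)"
    \<comment> \<open>The set \<open>insert x S\<close> is nonempty, so its two terms vanish in the
      limit. For empty \<open>S\<close> the other two give the average over the first Ising spin;
      otherwise they vanish as well.\<close>
    using lim[of S 1] lim[of "insert x S" 1] lim[of S "-1"] lim[of "insert x S" "-1"]
    by (cases "S = {}")
       (auto simp: expectation_ising_zero_coupling_Suc intro!: tendsto_eq_intros)
  ultimately show ?case by (simp only:)
qed

section \<open>Random initial configurations and the limit of the observable\<close>

theorem theorem6p2:
  fixes M :: "'w measure"
    and \<gamma> :: real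
    and \<xi> \<phi> :: "int \<Rightarrow> nat \<Rightarrow> 'w \<Rightarrow> real"
    and P0 :: "(int \<Rightarrow> real) measure"
    and K :: "real \<Rightarrow> real"
    and scale :: "nat \<Rightarrow> real"
    and m :: nat
    and xs :: "int list"
    and f :: "real list \<Rightarrow> real"
  assumes "prob_space M"
    and noise_gaussian: "\<And>x t. distributed M lborel (\<xi> x t) std_normal_density"
    and noise_indep: "prob_space.indep_vars M (\<lambda>_. borel) (\<lambda>(x, t). \<xi> x t) UNIV"
    and noise_indep_initial: "indep_random_elements M
          spin_configs (\<lambda>\<omega> x. \<phi> x 0 \<omega>)
          (\<Pi>\<^sub>M p\<in>UNIV. borel) (\<lambda>\<omega> (x, t). \<xi> x t \<omega>)"
    and initial: "distr M spin_configs (\<lambda>\<omega> x. \<phi> x 0 \<omega>) = P0"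
    and dynamic: "noisy_sign_dynamic M \<gamma> (\<lambda>t. K (scale t)) \<xi> \<phi>"
    and scaling: "mono scale" "filterlim scale at_top sequentially"
    and coupling: "(\<lambda>t. K (scale t)) \<longlonglongrightarrow> 0"
    and sites: "m \<ge> 1" "length xs = m" "distinct xs"
  shows "(\<lambda>t. finite_point_observable M \<phi> f xs t)
           \<longlonglongrightarrow> measure_pmf.expectation (ising_zero_coupling m) (\<lambda>\<sigma>. (f \<sigma>)\<^sup>2)"
proof -
  interpret prob_space M by fact
  define \<Xi> where "\<Xi> = (\<lambda>(x, t). \<xi> x t)"
  define k where "k = (\<lambda>t. K (scale t))"
  define \<phi>0 where "\<phi>0 = (\<lambda>\<omega> x. \<phi> x 0 \<omega>)"
  have gauss: "distributed M lborel (\<Xi> p) std_normal_density" for p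
    by (cases p) (simp add: \<Xi>_def noise_gaussian)
  have ind: "indep_vars (\<lambda>_. borel) \<Xi> UNIV"
    using noise_indep by (simp add: \<Xi>_def)
  have \<Xi>_eq: "(\<lambda>\<omega> (x, t). \<xi> x t \<omega>) = (\<lambda>\<omega> p. \<Xi> p \<omega>)"
    by (simp add: \<Xi>_def fun_eq_iff)
  have ind0: "indep_random_elements M spin_configs \<phi>0 (PiM UNIV (\<lambda>_. borel)) (\<lambda>\<omega> p. \<Xi> p \<omega>)"
    using noise_indep_initial unfolding \<Xi>_eq \<phi>0_def .
  then have meas [measurable]: "\<phi>0 \<in> M \<rightarrow>\<^sub>M spin_configs" "(\<lambda>\<omega> p. \<Xi> p \<omega>) \<in> M \<rightarrow>\<^sub>M PiM UNIV (\<lambda>_. borel)"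
    by (auto simp: indep_random_elements_def)
  have k: "k \<longlonglongrightarrow> 0" using coupling by (simp add: k_def)
  have \<phi>: "\<phi> x t \<in> M \<rightarrow>\<^sub>M count_space {-1, 1}" for x t
    using dynamic by (simp add: noisy_sign_dynamic_def)
  have \<phi>_step: "AE \<omega> in M. \<phi> x (t + 1) \<omega> =
      sgn (k t * (\<phi> (x - 1) t \<omega> + \<phi> (x + 1) t \<omega>) + (1 - \<gamma>) * \<phi> x t \<omega> + \<xi> x t \<omega>)" for x t
    using dynamic by (simp add: noisy_sign_dynamic_def k_def)
  \<comment> \<open>The given process is almost surely the solution map applied to its own start and
    noise. The sites are countable, so one null set serves them all.\<close>
  have \<phi>_evolve: "AE \<omega> in M. \<forall>x. \<phi> x t \<omega> = evolve \<gamma> k (\<phi>0 \<omega>) (\<lambda>p. \<Xi> p \<omega>) t x" for t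
  proof (induction t)
    case 0
    show ?case by (simp add: \<phi>0_def)
  next
    case (Suc t)
    have "AE \<omega> in M. \<forall>x. \<phi> x (t + 1) \<omega> =
        sgn (k t * (\<phi> (x - 1) t \<omega> + \<phi> (x + 1) t \<omega>) + (1 - \<gamma>) * \<phi> x t \<omega> + \<xi> x t \<omega>)"
      using \<phi>_step by (simp add: AE_all_countable)
    with Suc AE_space show ?case
    proof eventually_elim
      case (elim \<omega>)
      show ?case
      proof
        fix x
        \<comment> \<open>Being a spin rules out a zero argument of \<open>sgn\<close>, the only
          place where it differs from \<open>spin_sign\<close>.\<close>
        have "\<phi> x (Suc t) \<omega> \<in> {-1, 1}"
          using measurable_space[OF \<phi> elim(2)] by simp
        moreover have "\<phi> x (Suc t) \<omega> = sgn (local_field \<gamma> (k t) (evolve \<gamma> k (\<phi>0 \<omega>) (\<lambda>p. \<Xi> p \<omega>) t) x + \<Xi> (x, t) \<omega>)"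
          using elim by (simp add: local_field_def \<Xi>_def)
        ultimately show "\<phi> x (Suc t) \<omega> = evolve \<gamma> k (\<phi>0 \<omega>) (\<lambda>p. \<Xi> p \<omega>) (Suc t) x"
          by (auto simp: spin_sign_def sgn_if split: if_splits)
      qed
    qed
  qed
  have decay: "(\<lambda>t. expectation (\<lambda>\<omega>. \<Prod>x\<in>S. \<phi> x t \<omega>)) \<longlonglongrightarrow> 0" if S: "finite S" "S \<noteq> {}" for S
  proof -
    \<comment> \<open>The value 0 off the spin configurations makes the bound 1 hold for every
      \<open>\<sigma>\<close>, as \<open>expectation_decouple\<close> demands.\<close>
    define g where "g t = (\<lambda>(\<sigma>, \<eta>). if \<sigma> \<in> space spin_configs then \<Prod>x\<in>S. evolve \<gamma> k \<sigma> \<eta> t x else 0)" for t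
    note [measurable] = evolve_measurable[of _ UNIV, simplified, unfolded split_beta']
    have g_meas [measurable]: "g t \<in> borel_measurable (spin_configs \<Otimes>\<^sub>M PiM UNIV (\<lambda>_. borel))" for t
      unfolding g_def split_beta'
      by measurable
    have g_bound: "\<bar>g t (\<sigma>, \<eta>)\<bar> \<le> 1" for t \<sigma> \<eta>
      by (auto simp: g_def abs_evolve intro!: abs_prod_le_1)
    have g_eq: "g t (\<phi>0 \<omega>, \<eta>) = (\<Prod>x\<in>S. evolve \<gamma> k (\<phi>0 \<omega>) \<eta> t x)" if "\<omega> \<in> space M" for t \<omega> \<eta>
      using measurable_space[OF meas(1) that] by (simp add: g_def)
    have "expectation (\<lambda>\<omega>. \<Prod>x\<in>S. \<phi> x t \<omega>) = expectation (\<lambda>\<omega>. g t (\<phi>0 \<omega>, \<lambda>p. \<Xi> p \<omega>))" for t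
    proof (rule integral_cong_AE)
      show "AE \<omega> in M. (\<Prod>x\<in>S. \<phi> x t \<omega>) = g t (\<phi>0 \<omega>, \<lambda>p. \<Xi> p \<omega>)"
        using \<phi>_evolve[of t] AE_space by eventually_elim (simp add: g_eq)
      show "(\<lambda>\<omega>. \<Prod>x\<in>S. \<phi> x t \<omega>) \<in> borel_measurable M"
        by (intro borel_measurable_prod borel_measurable_count_space_spins \<phi>)
    qed measurable
    also have "expectation (\<lambda>\<omega>. g t (\<phi>0 \<omega>, \<lambda>p. \<Xi> p \<omega>))
        = expectation (\<lambda>\<omega>. expectation (\<lambda>\<omega>'. g t (\<phi>0 \<omega>, \<lambda>p. \<Xi> p \<omega>')))" for t
      by (rule expectation_decouple[OF ind0 g_meas g_bound])
    finally have eq: "expectation (\<lambda>\<omega>. \<Prod>x\<in>S. \<phi> x t \<omega>)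
        = expectation (\<lambda>\<omega>. expectation (\<lambda>\<omega>'. g t (\<phi>0 \<omega>, \<lambda>p. \<Xi> p \<omega>')))" for t .
    \<comment> \<open>The inner expectation starts from a frozen configuration, so the decay for
      fixed starts applies at each outcome; the bound 1 lets the limit pass through the outer
      expectation.\<close>
    have "(\<lambda>t. expectation (\<lambda>\<omega>. expectation (\<lambda>\<omega>'. g t (\<phi>0 \<omega>, \<lambda>p. \<Xi> p \<omega>')))) \<longlonglongrightarrow> expectation (\<lambda>_. 0)"
    proof (rule integral_dominated_convergence[where w = "\<lambda>_. 1"])
      show "AE \<omega> in M. (\<lambda>t. expectation (\<lambda>\<omega>'. g t (\<phi>0 \<omega>, \<lambda>p. \<Xi> p \<omega>'))) \<longlonglongrightarrow> 0"
        using expectation_prod_evolve_tendsto_0[OF gauss ind _ S k] measurable_space[OF meas(1)]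
        by (intro AE_I2) (simp add: g_eq)
      show "AE \<omega> in M. norm (expectation (\<lambda>\<omega>'. g t (\<phi>0 \<omega>, \<lambda>p. \<Xi> p \<omega>'))) \<le> 1" for t
      proof (intro AE_I2)
        fix \<omega> assume [simp]: "\<omega> \<in> space M"
        have "expectation (\<lambda>\<omega>'. \<bar>g t (\<phi>0 \<omega>, \<lambda>p. \<Xi> p \<omega>')\<bar>) \<le> 1"
          by (intro integral_le_const) (auto simp: g_bound intro!: integrable_const_bound[where B = 1])
        then show "norm (expectation (\<lambda>\<omega>'. g t (\<phi>0 \<omega>, \<lambda>p. \<Xi> p \<omega>'))) \<le> 1"
          unfolding real_norm_def by (rule order_trans[OF integral_abs_bound])
      qed
    qed auto
    then show ?thesis by (simp add: eq)
  qed
  \<comment> \<open>The observable looks at time \<open>t + 1\<close>, hence the shift.\<close>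
  have "(\<lambda>t. expectation (\<lambda>\<omega>. \<Prod>x\<in>S. \<phi> x (t + 1) \<omega>)) \<longlonglongrightarrow> 0" if "finite S" "S \<noteq> {}" for S
    using decay[OF that] by (rule LIMSEQ_ignore_initial_segment)
  \<comment> \<open>With \<open>S\<close> empty the extra product is 1 and the limit is the Ising
    expectation.\<close>
  from tendsto_expectation_ising_zero_coupling[where s = "\<lambda>x t. \<phi> x (t + 1)" and S = "{}"
      and xs = xs and g = "\<lambda>\<sigma>. (f \<sigma>)\<^sup>2", OF \<phi> this]
  show ?thesis
    using sites by (simp add: finite_point_observable_def)
qed

end
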